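(* Let $\varepsilon>0$ and let $S:\mathbb{R}\to\mathbb{R}$ be a smooth function with nonnegative fourth-order derivative, $S''''(v)\ge0$ for all $v\in\mathbb{R}$. Let $\mathbf{M}=\mathbf{M}(t,x)$ be a smooth solution with values in $\Omega$ of the viscous system $$\partial_t\mathbf{M}+\partial_x\mathbf{F}(\mathbf{M})=\varepsilon\,\partial_{xx}\mathbf{M}.$$ Then the pair $$\eta=\rho_1S(v_1)+\rho_2S(v_2),\qquad q=\rho_1v_1S(v_1)+\rho_2v_2S(v_2),$$ where $\rho_1,\rho_2,v_1,v_2$ are the weights and abscissas associated with $\mathbf{M}(t,x)$, satisfies the entropy inequality $$\partial_t\eta+\partial_xq\le\varepsilon\,\partial_{xx}\eta .$$ In particular, this holds for $S(v)=v^{2\alpha}$ with $\alpha$ an integer, $\alpha\ge2$.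
   Context: Moment space: $\Omega=\{\mathbf{M}=(M_0,M_1,M_2,M_3)^t\in\mathbb{R}^4: M_0>0,\ M_0M_2-M_1^2>0\}$. For each $\mathbf{M}\in\Omega$ there are unique weights $\rho_1,\rho_2>0$ and abscissas $v_1>v_2$ with $M_i=\rho_1v_1^i+\rho_2v_2^i$ for $i=0,1,2,3$. The flux is $\mathbf{F}(\mathbf{M})=(M_1,M_2,M_3,\overline{M_4})^t$ with $\overline{M_4}=\rho_1v_1^4+\rho_2v_2^4$. *)

theory Defs
  imports "HOL-Analysis.Analysis"
begin

text \<open>
  A moment vector \<open>(M\<^sub>0, M\<^sub>1, M\<^sub>2, M\<^sub>3)\<close> is an element of \<^typ>\<open>real ^ 4\<close>. The components of
  that type are numbered from 1, so the moment of order \<open>k\<close> is component \<open>k + 1\<close>.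
\<close>

definition moment_space :: "(real ^ 4) set" where
  "moment_space = {M. M $ 1 > 0 \<and> M $ 1 * M $ 3 - (M $ 2)^2 > 0}"

definition is_quadrature :: "real ^ 4 \<Rightarrow> real \<times> real \<times> real \<times> real \<Rightarrow> bool" where
  "is_quadrature M = (\<lambda>(r1, r2, u1, u2). r1 > 0 \<and> r2 > 0 \<and> u1 > u2
     \<and> M $ 1 = r1 + r2
     \<and> M $ 2 = r1 * u1 + r2 * u2
     \<and> M $ 3 = r1 * u1 ^ 2 + r2 * u2 ^ 2
     \<and> M $ 4 = r1 * u1 ^ 3 + r2 * u2 ^ 3)"

lemma is_quadrature_exists:
  assumes "M \<in> moment_space"
  shows "\<exists>z. is_quadrature M z"
proof -
  define a where "a = M $ 1"
  define m where "m = M $ 2 / a"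
  define w where "w = M $ 3 / a - m^2"
  define c where "c = (M $ 4 / a - 3 * m * w - m^3) / w"
  have a: "a > 0" and "a * M $ 3 - (M $ 2)^2 > 0"
    using assms by (auto simp: moment_space_def a_def)
  moreover have w_eq: "w * a^2 = a * M $ 3 - (M $ 2)^2"
    using a by (simp add: w_def m_def field_simps power2_eq_square)
  ultimately have "w * a^2 > 0" by simp
  hence w: "w > 0" by (simp add: zero_less_mult_iff)
  define d where "d = sqrt (c^2 + 4 * w)"
  have dd: "d^2 = c^2 + 4 * w" using w by (simp add: d_def add_nonneg_nonneg)
  have "\<bar>c\<bar> < d" unfolding d_def using w by (intro real_less_rsqrt) auto
  hence d: "d > 0" "c < d" "- c < d" by auto
  define x where "x = (c + d) / 2"
  define y where "y = (c - d) / 2"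
  have x: "x > 0" and y: "y < 0" using d by (auto simp: x_def y_def)
  have sum: "x + y = c" by (simp add: x_def y_def field_simps)
  have prod: "x * y = - w" using dd by (simp add: x_def y_def field_simps power2_eq_square)
  define r where "r = - a * y / (x - y)"
  define s where "s = a * x / (x - y)"
  have xy: "x - y > 0" using x y by simp
  have r: "r > 0" using a x y by (auto simp: r_def divide_simps mult_less_0_iff)
  have s: "s > 0" using a x y by (auto simp: s_def divide_simps)
  have m0: "r + s = a"
  proof -
    have "r + s = a * (x - y) / (x - y)"
      by (simp add: r_def s_def diff_divide_distrib right_diff_distrib)
    thus ?thesis using xy by simp
  qed
  have m1: "r * x + s * y = 0" by (simp add: r_def s_def field_simps)
  have qx: "x^2 = c * x + w" and qy: "y^2 = c * y + w"
    using prod by (simp_all add: sum[symmetric] power2_eq_square algebra_simps)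
  have "r * x^2 + s * y^2 = c * (r * x + s * y) + w * (r + s)"
    unfolding qx qy by (simp add: algebra_simps)
  hence m2: "r * x^2 + s * y^2 = w * a" by (simp add: m0 m1)
  have "r * x^3 + s * y^3 = r * (x * x^2) + s * (y * y^2)"
    by (simp add: power3_eq_cube power2_eq_square)
  also have "\<dots> = c * (r * x^2 + s * y^2) + w * (r * x + s * y)"
    (is "?l = ?r")
  proof -
    have "?l = r * (x * (c * x + w)) + s * (y * (c * y + w))" by (simp only: qx qy)
    also have "\<dots> = ?r" by (simp add: algebra_simps power2_eq_square)
    finally show ?thesis .
  qed
  finally have m3: "r * x^3 + s * y^3 = c * w * a" by (simp add: m1 m2)
  have "M $ 2 = m * a" "M $ 3 = (w + m^2) * a" "M $ 4 = (c * w + 3 * m * w + m^3) * a"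
    using a w by (simp_all add: m_def w_def c_def)
  moreover have "r * (m + x) + s * (m + y) = m * (r + s) + (r * x + s * y)"
    by (simp add: algebra_simps)
  moreover have "r * (m + x)^2 + s * (m + y)^2
      = m^2 * (r + s) + 2 * m * (r * x + s * y) + (r * x^2 + s * y^2)"
    by (simp add: algebra_simps power2_eq_square)
  moreover have "r * (m + x)^3 + s * (m + y)^3
      = m^3 * (r + s) + 3 * m^2 * (r * x + s * y) + 3 * m * (r * x^2 + s * y^2)
        + (r * x^3 + s * y^3)"
    by (simp add: algebra_simps power2_eq_square power3_eq_cube)
  ultimately have "is_quadrature M (r, s, m + x, m + y)"
    using r s xy by (simp add: is_quadrature_def m0 m1 m2 m3 a_def[symmetric] algebra_simps)
  thus ?thesis ..
qed

lemma is_quadrature_unique: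
  assumes "is_quadrature M (r1, r2, u1, u2)" and "is_quadrature M (s1, s2, w1, w2)"
  shows "(r1, r2, u1, u2) = (s1, s2, w1, w2)"
proof -
  have pos: "r1 > 0" "r2 > 0" "u1 > u2" "s1 > 0" "s2 > 0" "w1 > w2"
    and e0: "r1 + r2 = s1 + s2"
    and e1: "r1 * u1 + r2 * u2 = s1 * w1 + s2 * w2"
    and e2: "r1 * u1^2 + r2 * u2^2 = s1 * w1^2 + s2 * w2^2"
    and e3: "r1 * u1^3 + r2 * u2^3 = s1 * w1^3 + s2 * w2^3"
    using assms by (auto simp: is_quadrature_def)
  have test: "r1 * (A + B * u1 + C * u1^2 + D * u1^3) + r2 * (A + B * u2 + C * u2^2 + D * u2^3)
      = s1 * (A + B * w1 + C * w1^2 + D * w1^3) + s2 * (A + B * w2 + C * w2^2 + D * w2^3)"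
    for A B C D :: real
  proof -
    have "A * (r1 + r2) + B * (r1 * u1 + r2 * u2) + C * (r1 * u1^2 + r2 * u2^2)
        + D * (r1 * u1^3 + r2 * u2^3)
      = A * (s1 + s2) + B * (s1 * w1 + s2 * w2) + C * (s1 * w1^2 + s2 * w2^2)
        + D * (s1 * w1^3 + s2 * w2^3)"
      by (simp only: e0 e1 e2 e3)
    thus ?thesis by (simp add: algebra_simps)
  qed
  have orth: "s1 * ((p + q * w1) * ((w1 - u1) * (w1 - u2)))
      + s2 * ((p + q * w2) * ((w2 - u1) * (w2 - u2))) = 0" for p q :: real
    using test[of "p * (u1 * u2)" "q * (u1 * u2) - p * (u1 + u2)" "p - q * (u1 + u2)" q]
    by (simp add: algebra_simps power2_eq_square power3_eq_cube)
  have "s1 * ((w1 - w2) * ((w1 - u1) * (w1 - u2))) = 0"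
    using orth[of "- w2" 1] by (simp add: algebra_simps)
  hence r: "w1 = u1 \<or> w1 = u2" using pos by auto
  have "s2 * ((w2 - w1) * ((w2 - u1) * (w2 - u2))) = 0"
    using orth[of "- w1" 1] by (simp add: algebra_simps)
  hence "w2 = u1 \<or> w2 = u2" using pos by auto
  with r pos have u: "w1 = u1" "w2 = u2" by auto
  have "(r1 - s1) * (u1 - u2) = (r1 * u1 + r2 * u2) - (s1 * u1 + s2 * u2)
      - u2 * ((r1 + r2) - (s1 + s2))"
    by (simp add: algebra_simps)
  also have "\<dots> = 0" using e0 e1 u by simp
  finally have "r1 = s1" using pos by simp
  thus ?thesis using u e0 by simp
qed

lemma is_quadrature_ex1:
  assumes "M \<in> moment_space"
  shows "\<exists>!z. is_quadrature M z"
  using is_quadrature_exists[OF assms] is_quadrature_unique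
  by (metis prod_cases4)

definition quadrature :: "real ^ 4 \<Rightarrow> real \<times> real \<times> real \<times> real" where
  "quadrature M = (THE z. is_quadrature M z)"

definition rho1 :: "real ^ 4 \<Rightarrow> real" where
  "rho1 M = (case quadrature M of (r1, r2, u1, u2) \<Rightarrow> r1)"

definition rho2 :: "real ^ 4 \<Rightarrow> real" where
  "rho2 M = (case quadrature M of (r1, r2, u1, u2) \<Rightarrow> r2)"

definition v1 :: "real ^ 4 \<Rightarrow> real" where
  "v1 M = (case quadrature M of (r1, r2, u1, u2) \<Rightarrow> u1)"

definition v2 :: "real ^ 4 \<Rightarrow> real" where
  "v2 M = (case quadrature M of (r1, r2, u1, u2) \<Rightarrow> u2)"

definition flux :: "real ^ 4 \<Rightarrow> real ^ 4" where
  "flux M = vector [M $ 2, M $ 3, M $ 4, rho1 M * v1 M ^ 4 + rho2 M * v2 M ^ 4]"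

definition entropy :: "(real \<Rightarrow> real) \<Rightarrow> real ^ 4 \<Rightarrow> real" where
  "entropy S M = rho1 M * S (v1 M) + rho2 M * S (v2 M)"

definition entropy_flux :: "(real \<Rightarrow> real) \<Rightarrow> real ^ 4 \<Rightarrow> real" where
  "entropy_flux S M = rho1 M * v1 M * S (v1 M) + rho2 M * v2 M * S (v2 M)"

text \<open>
  For an open set \<open>D\<close>, \<open>Ck_on n D f\<close> means that \<open>f\<close> is \<open>n\<close> times continuously differentiable
  on \<open>D\<close>: all iterated directional derivatives of order at most \<open>n\<close> exist and are continuous.
\<close>

primrec Ck_on :: "nat \<Rightarrow> 'a::real_normed_vector set \<Rightarrow> ('a \<Rightarrow> 'b::real_normed_vector) \<Rightarrow> bool" where
  "Ck_on 0 D f \<longleftrightarrow> continuous_on D f"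
| "Ck_on (Suc n) D f \<longleftrightarrow> (\<forall>p\<in>D. f differentiable (at p))
     \<and> (\<forall>h. Ck_on n D (\<lambda>p. frechet_derivative f (at p) h))"

definition smooth_on :: "'a::real_normed_vector set \<Rightarrow> ('a \<Rightarrow> 'b::real_normed_vector) \<Rightarrow> bool" where
  "smooth_on D f \<longleftrightarrow> (\<forall>n. Ck_on n D f)"

text \<open>Functions of time and space take the pair \<open>(t, x)\<close> as argument.\<close>

definition partial_t :: "(real \<times> real \<Rightarrow> 'a::real_normed_vector) \<Rightarrow> real \<times> real \<Rightarrow> 'a" where
  "partial_t f = (\<lambda>(t, x). vector_derivative (\<lambda>s. f (s, x)) (at t))"

definition partial_x :: "(real \<times> real \<Rightarrow> 'a::real_normed_vector) \<Rightarrow> real \<times> real \<Rightarrow> 'a" where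
  "partial_x f = (\<lambda>(t, x). vector_derivative (\<lambda>y. f (t, y)) (at x))"

definition viscous_solution :: "real \<Rightarrow> (real \<times> real) set \<Rightarrow> (real \<times> real \<Rightarrow> real ^ 4) \<Rightarrow> bool" where
  "viscous_solution \<epsilon> D M \<longleftrightarrow> (\<forall>p\<in>D.
     partial_t M p + partial_x (flux \<circ> M) p = \<epsilon> *\<^sub>R partial_x (partial_x M) p)"

definition entropy_inequality ::
    "real \<Rightarrow> (real \<times> real) set \<Rightarrow> (real \<times> real \<Rightarrow> real ^ 4) \<Rightarrow> (real \<Rightarrow> real) \<Rightarrow> bool" where
  "entropy_inequality \<epsilon> D M S \<longleftrightarrow> (\<forall>p\<in>D.
     partial_t (entropy S \<circ> M) p + partial_x (entropy_flux S \<circ> M) p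
       \<le> \<epsilon> * partial_x (partial_x (entropy S \<circ> M)) p)"

end

theory Submission
  imports Defs
begin

text \<open>
  Fix a point of the domain and let \<open>H\<close> be the cubic Hermite interpolant of \<open>S\<close> at the two
  abscissas there. The pair \<open>(\<eta>, q)\<close> belonging to \<open>H\<close> is a fixed linear combination of the
  components of \<open>M\<close> and of its flux, so it satisfies the entropy relation with equality. The
  remainder \<open>T = S - H\<close> has double zeros at both abscissas, hence contributes nothing to the first
  derivatives of \<open>\<eta>\<close> and \<open>q\<close>, while its contribution to the second derivative of \<open>\<eta>\<close> is the
  sum of \<open>\<rho> T''(v) (\<partial>v/\<partial>x)\<^sup>2\<close> over the two abscissas. It is nonnegative because
  \<open>T'''' \<ge> 0\<close> forces \<open>T'' \<ge> 0\<close> at the double zeros.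
\<close>

section \<open>Calculus of prescribed first and second derivatives at a point\<close>

text \<open>The derivative function must exist on a whole neighbourhood, since otherwise a second
  derivative at \<open>x\<close> would have no meaning. The values \<open>a\<close> and
  \<open>b\<close> are arguments, so that the rules below compute them as
  \<open>has_real_derivative\<close> does.\<close>

definition has_two_derivatives :: "(real \<Rightarrow> real) \<Rightarrow> real \<Rightarrow> real \<Rightarrow> real \<Rightarrow> bool" where
  "has_two_derivatives f a b x \<longleftrightarrow> (\<exists>f'. (\<forall>\<^sub>F y in nhds x. (f has_real_derivative f' y) (at y))
     \<and> f' x = a \<and> (f' has_real_derivative b) (at x))"

lemma has_two_derivativesI:
  assumes "\<forall>\<^sub>F y in nhds x. (f has_real_derivative f' y) (at y)"
    and "(f' has_real_derivative b) (at x)" and "f' x = a"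
  shows "has_two_derivatives f a b x"
  using assms unfolding has_two_derivatives_def by blast

lemma has_two_derivativesE:
  assumes "has_two_derivatives f a b x"
  obtains f' where "\<forall>\<^sub>F y in nhds x. (f has_real_derivative f' y) (at y)"
    and "(f' has_real_derivative b) (at x)" and "f' x = a"
  using assms unfolding has_two_derivatives_def by blast

lemma has_two_derivatives_imp_DERIV:
  assumes "has_two_derivatives f a b x"
  shows "(f has_real_derivative a) (at x)"
  using assms by (auto simp: has_two_derivatives_def dest: eventually_nhds_x_imp_x)

lemma has_two_derivatives_imp_vector_derivative:
  assumes "has_two_derivatives f a b x"
  shows "vector_derivative f (at x) = a"
  using has_two_derivatives_imp_DERIV[OF assms]
  by (simp add: has_real_derivative_iff_has_vector_derivative vector_derivative_at)

text \<open>This nested form is what \<open>partial_x (partial_x f)\<close> unfolds to. Near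
  \<open>x\<close> the inner derivative is the witness \<open>f'\<close>, and the outer derivative
  sees only a neighbourhood.\<close>

lemma has_two_derivatives_imp_vector_derivative2:
  assumes "has_two_derivatives f a b x"
  shows "vector_derivative (\<lambda>y. vector_derivative f (at y)) (at x) = b"
proof -
  obtain f' where f': "\<forall>\<^sub>F y in nhds x. (f has_real_derivative f' y) (at y)"
    and b: "(f' has_real_derivative b) (at x)"
    using assms by (rule has_two_derivativesE)
  have "\<forall>\<^sub>F y in nhds x. vector_derivative f (at y) = f' y"
    using f' by eventually_elim
      (simp add: has_real_derivative_iff_has_vector_derivative vector_derivative_at)
  hence "((\<lambda>y. vector_derivative f (at y)) has_real_derivative b) (at x)"
    using b by (simp only: DERIV_cong_ev[OF refl _ refl])
  thus ?thesis
    by (simp add: has_real_derivative_iff_has_vector_derivative vector_derivative_at)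
qed

lemma has_two_derivatives_cong:
  assumes "has_two_derivatives f a b x" and "\<forall>\<^sub>F y in nhds x. g y = f y"
  shows "has_two_derivatives g a b x"
proof -
  obtain f' where f': "\<forall>\<^sub>F y in nhds x. (f has_real_derivative f' y) (at y)"
    and b: "(f' has_real_derivative b) (at x)" and a: "f' x = a"
    using assms(1) by (rule has_two_derivativesE)
  \<comment> \<open>Agreement near \<open>x\<close> is also agreement near every \<open>y\<close>
    close to \<open>x\<close>, so the same \<open>f'\<close> serves as derivative of
    \<open>g\<close> there.\<close>
  have "\<forall>\<^sub>F y in nhds x. \<forall>\<^sub>F z in nhds y. g z = f z"
    using assms(2) by (simp only: eventually_eventually)
  hence "\<forall>\<^sub>F y in nhds x. (g has_real_derivative f' y) (at y)"
    using f' by eventually_elim (simp only: DERIV_cong_ev[OF refl _ refl])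
  thus ?thesis using b a by (rule has_two_derivativesI)
qed

lemma has_two_derivatives_const: "has_two_derivatives (\<lambda>y. c) 0 0 x"
  by (rule has_two_derivativesI[where f' = "\<lambda>y. 0"]) auto

lemma has_two_derivatives_add:
  assumes "has_two_derivatives f a b x" and "has_two_derivatives g c d x"
  shows "has_two_derivatives (\<lambda>y. f y + g y) (a + c) (b + d) x"
proof -
  obtain f' where f: "\<forall>\<^sub>F y in nhds x. (f has_real_derivative f' y) (at y)"
    "(f' has_real_derivative b) (at x)" "f' x = a"
    using assms(1) by (rule has_two_derivativesE)
  obtain g' where g: "\<forall>\<^sub>F y in nhds x. (g has_real_derivative g' y) (at y)"
    "(g' has_real_derivative d) (at x)" "g' x = c"
    using assms(2) by (rule has_two_derivativesE)
  show ?thesis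
  proof (rule has_two_derivativesI[where f' = "\<lambda>y. f' y + g' y"])
    show "\<forall>\<^sub>F y in nhds x. ((\<lambda>y. f y + g y) has_real_derivative f' y + g' y) (at y)"
      using f(1) g(1) by eventually_elim (auto intro: DERIV_add)
  qed (use f g in \<open>auto intro: DERIV_add\<close>)
qed

lemma has_two_derivatives_mult:
  assumes "has_two_derivatives f a b x" and "has_two_derivatives g c d x"
  shows "has_two_derivatives (\<lambda>y. f y * g y) (a * g x + f x * c) (b * g x + 2 * a * c + f x * d) x"
proof -
  obtain f' where f: "\<forall>\<^sub>F y in nhds x. (f has_real_derivative f' y) (at y)"
    "(f' has_real_derivative b) (at x)" "f' x = a"
    using assms(1) by (rule has_two_derivativesE)
  obtain g' where g: "\<forall>\<^sub>F y in nhds x. (g has_real_derivative g' y) (at y)"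
    "(g' has_real_derivative d) (at x)" "g' x = c"
    using assms(2) by (rule has_two_derivativesE)
  note d = assms[THEN has_two_derivatives_imp_DERIV]
  show ?thesis
  proof (rule has_two_derivativesI[where f' = "\<lambda>y. f' y * g y + f y * g' y"])
    show "\<forall>\<^sub>F y in nhds x. ((\<lambda>y. f y * g y) has_real_derivative f' y * g y + f y * g' y) (at y)"
      using f(1) g(1) by eventually_elim (auto intro!: derivative_eq_intros)
    show "((\<lambda>y. f' y * g y + f y * g' y) has_real_derivative b * g x + 2 * a * c + f x * d) (at x)"
      by (rule derivative_eq_intros f g d refl)+ (simp add: f g algebra_simps)
  qed (use f g in auto)
qed

lemma has_two_derivatives_compose:
  assumes f: "has_two_derivatives f a b x" and g: "has_two_derivatives g c d (f x)"
  shows "has_two_derivatives (\<lambda>y. g (f y)) (c * a) (d * a\<^sup>2 + c * b) x"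
proof -
  obtain f' where f': "\<forall>\<^sub>F y in nhds x. (f has_real_derivative f' y) (at y)"
    "(f' has_real_derivative b) (at x)" "f' x = a"
    using f by (rule has_two_derivativesE)
  obtain g' where g': "\<forall>\<^sub>F z in nhds (f x). (g has_real_derivative g' z) (at z)"
    "(g' has_real_derivative d) (at (f x))" "g' (f x) = c"
    using g by (rule has_two_derivativesE)
  have df: "(f has_real_derivative a) (at x)"
    using f by (rule has_two_derivatives_imp_DERIV)
  \<comment> \<open>Continuity of \<open>f\<close> at \<open>x\<close> pulls the neighbourhood of
    \<open>f x\<close> on which \<open>g\<close> is differentiable back to one of
    \<open>x\<close>.\<close>
  have "filterlim f (nhds (f x)) (nhds x)"
    using DERIV_isCont[OF df] by (simp add: isCont_def tendsto_at_iff_tendsto_nhds)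
  hence "\<forall>\<^sub>F y in nhds x. (g has_real_derivative g' (f y)) (at (f y))"
    by (rule eventually_compose_filterlim[OF g'(1)])
  hence ev: "\<forall>\<^sub>F y in nhds x. ((\<lambda>y. g (f y)) has_real_derivative g' (f y) * f' y) (at y)"
    using f'(1) by eventually_elim (rule DERIV_chain2)
  show ?thesis
  proof (rule has_two_derivativesI[OF ev])
    show "((\<lambda>y. g' (f y) * f' y) has_real_derivative d * a\<^sup>2 + c * b) (at x)"
      by (rule derivative_eq_intros DERIV_chain2[OF g'(2) df] f' refl)+
        (simp add: f' g' algebra_simps power2_eq_square)
  qed (use f' g' in simp)
qed

lemma has_two_derivatives_of_DERIV:
  assumes "\<And>y. (f has_real_derivative f' y) (at y)" and "\<And>y. (f' has_real_derivative f'' y) (at y)"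
  shows "has_two_derivatives f (f' x) (f'' x) x"
  by (rule has_two_derivativesI[where f' = f']) (use assms in auto)

section \<open>Twice differentiability at a point\<close>

text \<open>Hides the values of the derivatives. The weights and abscissas are only shown to be
  regular; their derivatives are named later without being computed.\<close>

definition twice_differentiable :: "(real \<Rightarrow> real) \<Rightarrow> real \<Rightarrow> bool" where
  "twice_differentiable f x \<longleftrightarrow> (\<exists>a b. has_two_derivatives f a b x)"

lemma twice_differentiableI:
  assumes "\<forall>\<^sub>F y in nhds x. (f has_real_derivative f' y) (at y)"
    and "(f' has_real_derivative b) (at x)"
  shows "twice_differentiable f x"
  unfolding twice_differentiable_def using has_two_derivativesI[OF assms refl] by blast

lemma twice_differentiable_const: "twice_differentiable (\<lambda>y. c) x"
  unfolding twice_differentiable_def using has_two_derivatives_const by blast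

lemma twice_differentiable_add:
  "twice_differentiable f x \<Longrightarrow> twice_differentiable g x \<Longrightarrow> twice_differentiable (\<lambda>y. f y + g y) x"
  unfolding twice_differentiable_def using has_two_derivatives_add by blast

lemma twice_differentiable_mult:
  "twice_differentiable f x \<Longrightarrow> twice_differentiable g x \<Longrightarrow> twice_differentiable (\<lambda>y. f y * g y) x"
  unfolding twice_differentiable_def using has_two_derivatives_mult by blast

lemma twice_differentiable_compose:
  "twice_differentiable f x \<Longrightarrow> twice_differentiable g (f x) \<Longrightarrow> twice_differentiable (\<lambda>y. g (f y)) x"
  unfolding twice_differentiable_def using has_two_derivatives_compose by blast

lemma twice_differentiable_cong:
  "twice_differentiable f x \<Longrightarrow> \<forall>\<^sub>F y in nhds x. g y = f y \<Longrightarrow> twice_differentiable g x"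
  unfolding twice_differentiable_def using has_two_derivatives_cong by blast

lemma twice_differentiable_diff:
  assumes "twice_differentiable f x" and "twice_differentiable g x"
  shows "twice_differentiable (\<lambda>y. f y - g y) x"
  using twice_differentiable_add[OF assms(1)
      twice_differentiable_mult[OF twice_differentiable_const[of "-1"] assms(2)]]
  by simp

lemma twice_differentiable_power:
  "twice_differentiable f x \<Longrightarrow> twice_differentiable (\<lambda>y. f y ^ n) x"
  by (induction n) (auto intro: twice_differentiable_const twice_differentiable_mult)

lemma twice_differentiable_inverse:
  assumes "x \<noteq> 0"
  shows "twice_differentiable inverse (x::real)"
proof -
  have "\<forall>\<^sub>F y in nhds x. y \<noteq> 0"
    using assms t1_space_nhds by blast
  hence "\<forall>\<^sub>F y in nhds x. (inverse has_real_derivative - (inverse y ^ 2)) (at y)"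
    by eventually_elim (use DERIV_inverse in \<open>force simp: numeral_2_eq_2\<close>)
  moreover have "((\<lambda>y. - (inverse y ^ 2)) has_real_derivative 2 * inverse x ^ 3) (at x)"
    using assms by (auto intro!: derivative_eq_intros simp: power2_eq_square power3_eq_cube)
  ultimately show ?thesis by (rule twice_differentiableI)
qed

lemma twice_differentiable_divide:
  assumes "twice_differentiable f x" and "twice_differentiable g x" and "g x \<noteq> 0"
  shows "twice_differentiable (\<lambda>y. f y / g y) x"
  using twice_differentiable_mult[OF assms(1)
      twice_differentiable_compose[OF assms(2) twice_differentiable_inverse[OF assms(3)]]]
  by (simp add: divide_inverse)

lemma twice_differentiable_sqrt:
  assumes "x > 0"
  shows "twice_differentiable sqrt x"
proof -
  have "\<forall>\<^sub>F y in nhds x. y > 0"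
    using assms eventually_nhds_in_open[of "{0<..}" x] by auto
  hence "\<forall>\<^sub>F y in nhds x. (sqrt has_real_derivative inverse (sqrt y) / 2) (at y)"
    by eventually_elim (rule DERIV_real_sqrt)
  moreover obtain b where "((\<lambda>y. inverse (sqrt y) / 2) has_real_derivative b) (at x)"
  proof
    show "((\<lambda>y. inverse (sqrt y) / 2) has_real_derivative
        - (inverse (sqrt x) * (inverse (sqrt x) / 2) * inverse (sqrt x)) / 2) (at x)"
      using assms by (auto intro!: derivative_eq_intros)
  qed
  ultimately show ?thesis by (rule twice_differentiableI)
qed

section \<open>Regularity of weights and abscissas as functions of the moments\<close>

lemma is_quadrature_quadrature:
  assumes "M \<in> moment_space"
  shows "is_quadrature M (rho1 M, rho2 M, v1 M, v2 M)"
proof -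
  have "is_quadrature M (quadrature M)"
    unfolding quadrature_def using is_quadrature_ex1[OF assms] by (rule theI')
  thus ?thesis
    by (cases "quadrature M") (simp add: rho1_def rho2_def v1_def v2_def)
qed

text \<open>
  The abscissas are the roots of the quadratic polynomial orthogonal to \<open>1\<close> and \<open>v\<close>; its
  coefficients, their sum and product, are rational in the moments.
\<close>

definition node_sum :: "real ^ 4 \<Rightarrow> real" where
  "node_sum M = (M $ 1 * M $ 4 - M $ 2 * M $ 3) / (M $ 1 * M $ 3 - (M $ 2)\<^sup>2)"

definition node_prod :: "real ^ 4 \<Rightarrow> real" where
  "node_prod M = (M $ 2 * M $ 4 - (M $ 3)\<^sup>2) / (M $ 1 * M $ 3 - (M $ 2)\<^sup>2)"

text \<open>With \<open>M\<close> expressed by the quadrature, the common denominator equals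
  \<open>r * s * (a - b)\<^sup>2\<close>, and the two numerators are this times \<open>a + b\<close>
  and \<open>a * b\<close>. The discriminant is then \<open>(a - b)\<^sup>2\<close>, and
  \<open>a > b\<close> decides which root is which. The weights solve the linear system given by the
  first two moments.\<close>

lemma quadrature_explicit:
  assumes "is_quadrature M (r, s, a, b)"
  shows "(node_sum M)\<^sup>2 - 4 * node_prod M > 0"
    and "a = (node_sum M + sqrt ((node_sum M)\<^sup>2 - 4 * node_prod M)) / 2"
    and "b = (node_sum M - sqrt ((node_sum M)\<^sup>2 - 4 * node_prod M)) / 2"
    and "r = (M $ 2 - b * M $ 1) / (a - b)"
    and "s = (a * M $ 1 - M $ 2) / (a - b)"
proof -
  have pos: "r > 0" "s > 0" "a > b"
    and m: "M $ 1 = r + s" "M $ 2 = r * a + s * b" "M $ 3 = r * a\<^sup>2 + s * b\<^sup>2"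
      "M $ 4 = r * a ^ 3 + s * b ^ 3"
    using assms by (auto simp: is_quadrature_def)
  have h: "M $ 1 * M $ 3 - (M $ 2)\<^sup>2 = r * s * (a - b)\<^sup>2"
    unfolding m by (simp add: algebra_simps power2_eq_square)
  have h_nz: "r * s * (a - b)\<^sup>2 \<noteq> 0" using pos by simp
  have "M $ 1 * M $ 4 - M $ 2 * M $ 3 = (a + b) * (r * s * (a - b)\<^sup>2)"
    unfolding m by (simp add: algebra_simps power2_eq_square power3_eq_cube)
  hence sum: "node_sum M = a + b"
    unfolding node_sum_def h using h_nz by simp
  have "M $ 2 * M $ 4 - (M $ 3)\<^sup>2 = (a * b) * (r * s * (a - b)\<^sup>2)"
    unfolding m by (simp add: algebra_simps power2_eq_square power3_eq_cube)
  hence prod: "node_prod M = a * b"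
    unfolding node_prod_def h using h_nz by simp
  have disc: "(node_sum M)\<^sup>2 - 4 * node_prod M = (a - b)\<^sup>2"
    unfolding sum prod by (simp add: algebra_simps power2_eq_square)
  show "(node_sum M)\<^sup>2 - 4 * node_prod M > 0"
    unfolding disc using pos by simp
  have root: "sqrt ((node_sum M)\<^sup>2 - 4 * node_prod M) = a - b"
    unfolding disc using pos by simp
  show "a = (node_sum M + sqrt ((node_sum M)\<^sup>2 - 4 * node_prod M)) / 2"
    and "b = (node_sum M - sqrt ((node_sum M)\<^sup>2 - 4 * node_prod M)) / 2"
    unfolding root unfolding sum by simp_all
  show "r = (M $ 2 - b * M $ 1) / (a - b)" and "s = (a * M $ 1 - M $ 2) / (a - b)"
    unfolding m using pos by (simp_all add: field_simps)
qed

text \<open>The quadrature is defined by a description, so regularity is read off the explicit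
  formulas, which hold near \<open>x\<close>. The abscissas come first because the formulas for the
  weights contain them.\<close>

lemma twice_differentiable_quadrature:
  fixes m :: "real \<Rightarrow> real ^ 4"
  assumes m: "\<And>k. twice_differentiable (\<lambda>y. m y $ k) x"
    and ev: "\<forall>\<^sub>F y in nhds x. m y \<in> moment_space"
  shows "twice_differentiable (\<lambda>y. rho1 (m y)) x"
    and "twice_differentiable (\<lambda>y. rho2 (m y)) x"
    and "twice_differentiable (\<lambda>y. v1 (m y)) x"
    and "twice_differentiable (\<lambda>y. v2 (m y)) x"
proof -
  note intros = twice_differentiable_const twice_differentiable_add twice_differentiable_diff
    twice_differentiable_mult twice_differentiable_divide twice_differentiable_power m
  have Q: "\<forall>\<^sub>F y in nhds x. is_quadrature (m y) (rho1 (m y), rho2 (m y), v1 (m y), v2 (m y))"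
    using ev by eventually_elim (rule is_quadrature_quadrature)
  note Qx = eventually_nhds_x_imp_x[OF Q]
  have "m x \<in> moment_space"
    using ev by (rule eventually_nhds_x_imp_x)
  hence "m x $ 1 * m x $ 3 - (m x $ 2)\<^sup>2 \<noteq> 0"
    by (simp add: moment_space_def)
  hence sum: "twice_differentiable (\<lambda>y. node_sum (m y)) x"
    and prod: "twice_differentiable (\<lambda>y. node_prod (m y)) x"
    unfolding node_sum_def node_prod_def by (auto intro!: intros)
  \<comment> \<open>The discriminant is positive at \<open>x\<close>, which keeps the square root
    away from its singularity at zero.\<close>
  have disc: "twice_differentiable (\<lambda>y. sqrt ((node_sum (m y))\<^sup>2 - 4 * node_prod (m y))) x"
    by (rule twice_differentiable_compose[where g = sqrt])
      (intro intros sum prod twice_differentiable_sqrt quadrature_explicit(1)[OF Qx])+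
  have "\<forall>\<^sub>F y in nhds x.
      v1 (m y) = (node_sum (m y) + sqrt ((node_sum (m y))\<^sup>2 - 4 * node_prod (m y))) / 2"
    using Q by eventually_elim (rule quadrature_explicit)
  thus v1: "twice_differentiable (\<lambda>y. v1 (m y)) x"
    by (rule twice_differentiable_cong[rotated]) (auto intro!: intros sum disc)
  have "\<forall>\<^sub>F y in nhds x.
      v2 (m y) = (node_sum (m y) - sqrt ((node_sum (m y))\<^sup>2 - 4 * node_prod (m y))) / 2"
    using Q by eventually_elim (rule quadrature_explicit)
  thus v2: "twice_differentiable (\<lambda>y. v2 (m y)) x"
    by (rule twice_differentiable_cong[rotated]) (auto intro!: intros sum disc)
  have ne: "v1 (m x) - v2 (m x) \<noteq> 0"
    using Qx by (simp add: is_quadrature_def)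
  have "\<forall>\<^sub>F y in nhds x. rho1 (m y) = (m y $ 2 - v2 (m y) * m y $ 1) / (v1 (m y) - v2 (m y))"
    using Q by eventually_elim (rule quadrature_explicit)
  thus "twice_differentiable (\<lambda>y. rho1 (m y)) x"
    by (rule twice_differentiable_cong[rotated]) (intro intros v1 v2 ne)
  have "\<forall>\<^sub>F y in nhds x. rho2 (m y) = (v1 (m y) * m y $ 1 - m y $ 2) / (v1 (m y) - v2 (m y))"
    using Q by eventually_elim (rule quadrature_explicit)
  thus "twice_differentiable (\<lambda>y. rho2 (m y)) x"
    by (rule twice_differentiable_cong[rotated]) (intro intros v1 v2 ne)
qed

section \<open>Cubic Hermite interpolation and the sign of the remainder's second derivative\<close>

text \<open>Newton's form with nodes \<open>b, b, a, a\<close>: the interpolant is \<open>fb + fb' *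
  (v - b) + p * (v - b)\<^sup>2 + q * (v - b)\<^sup>2 * (v - a)\<close>.\<close>

lemma hermite_interpolation:
  fixes a b :: real
  assumes "a \<noteq> b"
  obtains h0 h1 h2 h3 where
    "h0 + h1 * a + h2 * a\<^sup>2 + h3 * a ^ 3 = fa" "h1 + 2 * h2 * a + 3 * h3 * a\<^sup>2 = fa'"
    "h0 + h1 * b + h2 * b\<^sup>2 + h3 * b ^ 3 = fb" "h1 + 2 * h2 * b + 3 * h3 * b\<^sup>2 = fb'"
proof -
  define e where "e = a - b"
  have e: "e \<noteq> 0" and a: "a = b + e" using assms by (auto simp: e_def)
  \<comment> \<open>Matching the value at \<open>a\<close> determines \<open>p\<close>; matching the
    slope there then determines \<open>q\<close>. These are the divided differences over
    \<open>b, b, a\<close> and \<open>b, b, a, a\<close>.\<close>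
  define p where "p = (fa - fb - fb' * e) / e\<^sup>2"
  define q where "q = (fa' - fb' - 2 * e * p) / e\<^sup>2"
  have p: "p * e\<^sup>2 = fa - fb - fb' * e" using e by (simp add: p_def)
  have q: "q * e\<^sup>2 = fa' - fb' - 2 * e * p" using e by (simp add: q_def)
  show ?thesis
  \<comment> \<open>The coefficients of the Newton form expanded in powers of
    \<open>v\<close>.\<close>
  proof (rule that[where ?h0.0 = "fb - fb' * b + p * b\<^sup>2 - q * b\<^sup>2 * a"
        and ?h1.0 = "fb' - 2 * p * b + q * (b\<^sup>2 + 2 * a * b)"
        and ?h2.0 = "p - q * (a + 2 * b)" and ?h3.0 = q])
    show "fb - fb' * b + p * b\<^sup>2 - q * b\<^sup>2 * a + (fb' - 2 * p * b + q * (b\<^sup>2 + 2 * a * b)) * a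
      + (p - q * (a + 2 * b)) * a\<^sup>2 + q * a ^ 3 = fa"
      using p unfolding a by (simp add: algebra_simps power2_eq_square power3_eq_cube)
    show "fb' - 2 * p * b + q * (b\<^sup>2 + 2 * a * b) + 2 * (p - q * (a + 2 * b)) * a + 3 * q * a\<^sup>2 = fa'"
      using p q unfolding a by (simp add: algebra_simps power2_eq_square power3_eq_cube)
  qed (simp_all add: algebra_simps power2_eq_square power3_eq_cube)
qed

lemma DERIV_nonneg_imp_le:
  fixes f f' :: "real \<Rightarrow> real"
  assumes "\<And>v. (f has_real_derivative f' v) (at v)" and "\<And>v. c \<le> v \<Longrightarrow> v \<le> d \<Longrightarrow> f' v \<ge> 0"
    and "c \<le> d"
  shows "f c \<le> f d"
  using assms DERIV_nonneg_imp_nondecreasing by blast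

text \<open>
  By Rolle, the second derivative has two zeros between the double zeros \<open>a\<close> and \<open>b\<close>; being
  convex, it is nonnegative outside of them.
\<close>

lemma second_derivative_nonneg_at_double_zeros:
  fixes T T1 T2 T3 T4 :: "real \<Rightarrow> real"
  assumes T: "\<And>v. (T has_real_derivative T1 v) (at v)"
    and T1: "\<And>v. (T1 has_real_derivative T2 v) (at v)"
    and T2: "\<And>v. (T2 has_real_derivative T3 v) (at v)"
    and T3: "\<And>v. (T3 has_real_derivative T4 v) (at v)"
    and T4: "\<And>v. T4 v \<ge> 0"
    and z: "T a = 0" "T b = 0" "T1 a = 0" "T1 b = 0" and "b < a"
  shows "T2 a \<ge> 0" and "T2 b \<ge> 0"
proof -
  have rolle: "\<exists>z. c < z \<and> z < d \<and> f' z = 0"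
    if f: "\<And>v. (f has_real_derivative f' v) (at v)" and "f c = f d" "c < d"
    for f f' :: "real \<Rightarrow> real" and c d
    using MVT2[OF \<open>c < d\<close>, of f f'] that by auto
  obtain c where c: "b < c" "c < a" "T1 c = 0"
    using rolle[OF T] z \<open>b < a\<close> by metis
  obtain d where d: "b < d" "d < c" "T2 d = 0"
    using rolle[OF T1] z c by metis
  obtain e where e: "c < e" "e < a" "T2 e = 0"
    using rolle[OF T1] z c by metis
  \<comment> \<open>Since \<open>T3\<close> is nondecreasing and vanishes at \<open>u\<close>,
    \<open>T2\<close> decreases weakly left of \<open>u\<close> and increases weakly right of it. As
    \<open>b < d < u < e < a\<close>, this compares \<open>b\<close> with the zero \<open>d\<close>
    and \<open>a\<close> with the zero \<open>e\<close>.\<close>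
  obtain u where u: "d < u" "u < e" "T3 u = 0"
    using rolle[OF T2, of d e] d e by auto
  have mono: "T3 v \<le> T3 w" if "v \<le> w" for v w
    using DERIV_nonneg_imp_le[OF T3] T4 that by blast
  have "T2 e \<le> T2 a"
    by (rule DERIV_nonneg_imp_le[OF T2]) (use mono[of u] u e in auto)
  thus "T2 a \<ge> 0" using e by simp
  have "- T2 b \<le> - T2 d"
    by (rule DERIV_nonneg_imp_le[OF DERIV_minus[OF T2]]) (use mono[of _ u] u d in auto)
  thus "T2 b \<ge> 0" using d by simp
qed

section \<open>From smoothness to derivatives along lines\<close>

text \<open>On the real line the Frechet derivative in direction 1 is \<open>deriv\<close>. The
  recursion of \<open>Ck_on\<close> removes the first derivative taken, so the induction varies the
  function and moves on to \<open>deriv S\<close>.\<close>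

lemma Ck_on_imp_DERIV:
  fixes S :: "real \<Rightarrow> real"
  assumes "Ck_on n UNIV S" and "k < n"
  shows "((deriv ^^ k) S has_real_derivative (deriv ^^ Suc k) S v) (at v)"
  using assms
proof (induction k arbitrary: n S)
  case 0
  then obtain n' where "n = Suc n'" by (cases n) auto
  with 0 have "S differentiable (at v)" by simp
  thus ?case by (simp add: DERIV_deriv_iff_real_differentiable)
next
  case (Suc k)
  then obtain n' where n: "n = Suc n'" by (cases n) auto
  with Suc have S: "S differentiable (at p)" and C: "Ck_on n' UNIV (\<lambda>p. frechet_derivative S (at p) 1)"
    for p by auto
  have "frechet_derivative S (at p) 1 = deriv S p" for p
  proof -
    have "(S has_derivative (*) (deriv S p)) (at p)"
      using S[of p] by (simp add: DERIV_deriv_iff_real_differentiable[symmetric] has_field_derivative_def)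
    thus ?thesis by (simp flip: frechet_derivative_at)
  qed
  hence "Ck_on n' UNIV (deriv S)" using C by presburger
  thus ?case using Suc.IH[of n' "deriv S"] Suc.prems n by (simp del: funpow.simps add: funpow_Suc_right)
qed

text \<open>The curve has the constant velocity \<open>e\<close>, so differentiating along it gives
  the Frechet derivative in one fixed direction, a function that \<open>Ck_on\<close> controls
  again.\<close>

lemma twice_differentiable_along_line:
  fixes M :: "'a::real_normed_vector \<Rightarrow> real ^ 'n"
  assumes C: "Ck_on 2 D M" and "open D"
    and c: "\<And>s. (c has_vector_derivative e) (at s)" and x: "c x \<in> D"
  shows "twice_differentiable (\<lambda>s. M (c s) $ k) x"
proof -
  \<comment> \<open>Stated for arbitrary \<open>N\<close> because it is applied to \<open>M\<close>
    and then to the directional derivative of \<open>M\<close>.\<close>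
  have d: "((\<lambda>s. N (c s) $ k) has_real_derivative frechet_derivative N (at (c y)) e $ k) (at y)"
    if "N differentiable (at (c y))" for N :: "'a \<Rightarrow> real ^ 'n" and y
  proof -
    have N: "(N has_derivative frechet_derivative N (at (c y))) (at (c y))"
      using that by (simp add: frechet_derivative_works)
    hence "linear (frechet_derivative N (at (c y)))"
      by (rule has_derivative_linear)
    hence "((\<lambda>s. N (c s)) has_vector_derivative frechet_derivative N (at (c y)) e) (at y)"
      using has_derivative_compose[OF c[of y, unfolded has_vector_derivative_def] N]
      by (simp add: has_vector_derivative_def linear_scale)
    thus ?thesis
      using bounded_linear.has_vector_derivative[OF bounded_linear_vec_nth]
      unfolding has_real_derivative_iff_has_vector_derivative by blast
  qed
  have M1: "M differentiable (at p)" and M2: "(\<lambda>p. frechet_derivative M (at p) e) differentiable (at p)"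
    if "p \<in> D" for p
    using C that by (auto simp: numeral_2_eq_2)
  have "isCont c x" using c has_vector_derivative_continuous by blast
  hence "filterlim c (nhds (c x)) (nhds x)"
    by (simp add: isCont_def tendsto_at_iff_tendsto_nhds)
  moreover have "\<forall>\<^sub>F p in nhds (c x). p \<in> D"
    using \<open>open D\<close> x by (rule eventually_nhds_in_open)
  ultimately have ev: "\<forall>\<^sub>F y in nhds x. c y \<in> D"
    by (rule eventually_compose_filterlim[rotated])
  have "\<forall>\<^sub>F y in nhds x.
      ((\<lambda>s. M (c s) $ k) has_real_derivative frechet_derivative M (at (c y)) e $ k) (at y)"
    using ev by eventually_elim (intro d M1)
  thus ?thesis using d[OF M2[OF x]] by (rule twice_differentiableI)
qed

section \<open>Componentwise derivatives of curves of vectors\<close>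

lemma vector_derivative_vec_lambda:
  fixes f :: "real \<Rightarrow> real ^ 'n"
  assumes "\<And>k. ((\<lambda>s. f s $ k) has_real_derivative f' k) (at x)"
  shows "vector_derivative f (at x) = (\<chi> k. f' k)"
proof -
  have "(f has_derivative (\<lambda>h. h *\<^sub>R (\<chi> k. f' k))) (at x)"
    using assms
    by (subst has_derivative_componentwise_within)
      (auto simp: Basis_vec_def inner_axis has_field_derivative_def mult_commute_abs)
  thus ?thesis
    by (simp add: has_vector_derivative_def vector_derivative_at)
qed

lemma vector_derivative_nth:
  fixes f :: "real \<Rightarrow> real ^ 'n"
  assumes "\<And>k. has_two_derivatives (\<lambda>s. f s $ k) (f' k) (f'' k) x"
  shows "vector_derivative f (at x) $ k = f' k"
  by (subst vector_derivative_vec_lambda[OF has_two_derivatives_imp_DERIV[OF assms]]) simp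

lemma vector_derivative2_nth:
  fixes f :: "real \<Rightarrow> real ^ 'n"
  assumes "\<And>k. has_two_derivatives (\<lambda>s. f s $ k) (f' k) (f'' k) x"
  shows "vector_derivative (\<lambda>y. vector_derivative f (at y)) (at x) $ k = f'' k"
proof -
  have "\<forall>k. \<exists>g. (\<forall>\<^sub>F y in nhds x. ((\<lambda>s. f s $ k) has_real_derivative g y) (at y))
      \<and> (g has_real_derivative f'' k) (at x)"
    using assms unfolding has_two_derivatives_def by metis
  then obtain g where
    g: "\<And>k. \<forall>\<^sub>F y in nhds x. ((\<lambda>s. f s $ k) has_real_derivative g k y) (at y)"
    and f'': "\<And>k. (g k has_real_derivative f'' k) (at x)"
    by metis
  \<comment> \<open>Each component brings its own neighbourhood; finitely many of them intersect in
    a neighbourhood.\<close>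
  have "\<forall>\<^sub>F y in nhds x. \<forall>k. ((\<lambda>s. f s $ k) has_real_derivative g k y) (at y)"
    using g by (rule eventually_all_finite)
  hence "\<forall>\<^sub>F y in nhds x. vector_derivative f (at y) = (\<chi> k. g k y)"
    by eventually_elim (rule vector_derivative_vec_lambda, blast)
  hence "vector_derivative (\<lambda>y. vector_derivative f (at y)) (at x)
      = vector_derivative (\<lambda>y. \<chi> k. g k y) (at x)"
    by (intro vector_derivative_cong_eq) auto
  also have "\<dots> = (\<chi> k. f'' k)"
    by (rule vector_derivative_vec_lambda) (simp add: f'')
  finally show ?thesis by simp
qed

section \<open>The entropy pair along a curve of moments\<close>

lemma flux_nth:
  "flux M $ 1 = M $ 2" "flux M $ 2 = M $ 3" "flux M $ 3 = M $ 4"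
  "flux M $ 4 = rho1 M * v1 M ^ 4 + rho2 M * v2 M ^ 4"
  by (simp_all add: flux_def vector_def)

text \<open>In the product and chain rules every term except \<open>w * T'' * (u')\<^sup>2\<close>
  carries a factor \<open>T\<close> or \<open>T'\<close>, both zero at \<open>u x\<close>.\<close>

lemma has_two_derivatives_double_zero:
  assumes "has_two_derivatives w a b x" and "has_two_derivatives u c d x"
    and "has_two_derivatives T 0 e (u x)" and "T (u x) = 0"
  shows "has_two_derivatives (\<lambda>y. w y * T (u y)) 0 (w x * (e * c\<^sup>2)) x"
  using has_two_derivatives_mult[OF assms(1) has_two_derivatives_compose[OF assms(2,3)]] assms(4)
  by simp

lemma has_two_derivatives_cubic_combination:
  assumes "has_two_derivatives f0 a0 b0 x" and "has_two_derivatives f1 a1 b1 x"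
    and "has_two_derivatives f2 a2 b2 x" and "has_two_derivatives f3 a3 b3 x"
  shows "has_two_derivatives (\<lambda>y. h0 * f0 y + h1 * f1 y + h2 * f2 y + h3 * f3 y)
    (h0 * a0 + h1 * a1 + h2 * a2 + h3 * a3) (h0 * b0 + h1 * b1 + h2 * b2 + h3 * b3) x"
proof -
  have c: "has_two_derivatives (\<lambda>y. h * f y) (h * a) (h * b) x"
    if "has_two_derivatives f a b x" for f a b h
    using has_two_derivatives_mult[OF has_two_derivatives_const[of h] that] by simp
  show ?thesis by (intro has_two_derivatives_add c assms)
qed

text \<open>The polynomial \<open>H\<close> is frozen while the abscissas move with
  \<open>y\<close>. The quadrature is exact on cubics, so \<open>H\<close> contributes a constant
  combination of moments, and the remainder has double zeros at the abscissas belonging to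
  \<open>x\<close>. The numbers \<open>c1\<close> and \<open>c2\<close> are the derivatives of the
  abscissas; they enter through their squares.\<close>

lemma entropy_pair_along_curve:
  fixes m :: "real \<Rightarrow> real ^ 4" and h0 h1 h2 h3 :: real
  defines "H \<equiv> \<lambda>v. h0 + h1 * v + h2 * v\<^sup>2 + h3 * v ^ 3"
  assumes m: "\<And>k. has_two_derivatives (\<lambda>y. m y $ k) (m' k) (m'' k) x"
    and ev: "\<forall>\<^sub>F y in nhds x. m y \<in> moment_space"
    and F: "has_two_derivatives (\<lambda>y. flux (m y) $ 4) F' F'' x"
    and T1: "has_two_derivatives (\<lambda>v. S v - H v) 0 e1 (v1 (m x))" "S (v1 (m x)) = H (v1 (m x))"
    and T2: "has_two_derivatives (\<lambda>v. S v - H v) 0 e2 (v2 (m x))" "S (v2 (m x)) = H (v2 (m x))"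
  shows "\<exists>c1 c2. has_two_derivatives (\<lambda>y. entropy S (m y))
      (h0 * m' 1 + h1 * m' 2 + h2 * m' 3 + h3 * m' 4)
      (h0 * m'' 1 + h1 * m'' 2 + h2 * m'' 3 + h3 * m'' 4
        + rho1 (m x) * (e1 * c1\<^sup>2) + rho2 (m x) * (e2 * c2\<^sup>2)) x"
    and "\<exists>b. has_two_derivatives (\<lambda>y. entropy_flux S (m y))
      (h0 * m' 2 + h1 * m' 3 + h2 * m' 4 + h3 * F') b x"
proof -
  define T where "T v = S v - H v" for v
  have td: "twice_differentiable (\<lambda>y. m y $ k) x" for k
    using m[of k] unfolding twice_differentiable_def by blast
  note q = twice_differentiable_quadrature[OF td ev]
  obtain a1 b1 where r1: "has_two_derivatives (\<lambda>y. rho1 (m y)) a1 b1 x"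
    using q(1) unfolding twice_differentiable_def by blast
  obtain a2 b2 where r2: "has_two_derivatives (\<lambda>y. rho2 (m y)) a2 b2 x"
    using q(2) unfolding twice_differentiable_def by blast
  obtain c1 d1 where u1: "has_two_derivatives (\<lambda>y. v1 (m y)) c1 d1 x"
    using q(3) unfolding twice_differentiable_def by blast
  obtain c2 d2 where u2: "has_two_derivatives (\<lambda>y. v2 (m y)) c2 d2 x"
    using q(4) unfolding twice_differentiable_def by blast
  have T: "has_two_derivatives T 0 e1 (v1 (m x))" "T (v1 (m x)) = 0"
    "has_two_derivatives T 0 e2 (v2 (m x))" "T (v2 (m x)) = 0"
    using T1 T2 by (auto simp: T_def[abs_def])
  have Q: "\<forall>\<^sub>F y in nhds x. is_quadrature (m y) (rho1 (m y), rho2 (m y), v1 (m y), v2 (m y))"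
    using ev by eventually_elim (rule is_quadrature_quadrature)
  have "has_two_derivatives
      (\<lambda>y. h0 * m y $ 1 + h1 * m y $ 2 + h2 * m y $ 3 + h3 * m y $ 4
        + rho1 (m y) * T (v1 (m y)) + rho2 (m y) * T (v2 (m y)))
      (h0 * m' 1 + h1 * m' 2 + h2 * m' 3 + h3 * m' 4 + 0 + 0)
      (h0 * m'' 1 + h1 * m'' 2 + h2 * m'' 3 + h3 * m'' 4
        + rho1 (m x) * (e1 * c1\<^sup>2) + rho2 (m x) * (e2 * c2\<^sup>2)) x"
    by (intro has_two_derivatives_add[where f = "\<lambda>y. A y + B y" for A B]
        has_two_derivatives_cubic_combination m
        has_two_derivatives_double_zero[OF r1 u1] has_two_derivatives_double_zero[OF r2 u2] T)
  moreover have "\<forall>\<^sub>F y in nhds x. entropy S (m y)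
      = h0 * m y $ 1 + h1 * m y $ 2 + h2 * m y $ 3 + h3 * m y $ 4
        + rho1 (m y) * T (v1 (m y)) + rho2 (m y) * T (v2 (m y))"
    using Q by eventually_elim
      (simp add: entropy_def is_quadrature_def T_def H_def algebra_simps)
  ultimately show "\<exists>c1 c2. has_two_derivatives (\<lambda>y. entropy S (m y))
      (h0 * m' 1 + h1 * m' 2 + h2 * m' 3 + h3 * m' 4)
      (h0 * m'' 1 + h1 * m'' 2 + h2 * m'' 3 + h3 * m'' 4
        + rho1 (m x) * (e1 * c1\<^sup>2) + rho2 (m x) * (e2 * c2\<^sup>2)) x"
    by (intro exI[of _ c1] exI[of _ c2]) (rule has_two_derivatives_cong, simp_all)
  note w1 = has_two_derivatives_mult[OF r1 u1] and w2 = has_two_derivatives_mult[OF r2 u2]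
  have "has_two_derivatives
      (\<lambda>y. h0 * m y $ 2 + h1 * m y $ 3 + h2 * m y $ 4 + h3 * flux (m y) $ 4
        + rho1 (m y) * v1 (m y) * T (v1 (m y)) + rho2 (m y) * v2 (m y) * T (v2 (m y)))
      (h0 * m' 2 + h1 * m' 3 + h2 * m' 4 + h3 * F' + 0 + 0)
      (h0 * m'' 2 + h1 * m'' 3 + h2 * m'' 4 + h3 * F''
        + rho1 (m x) * v1 (m x) * (e1 * c1\<^sup>2) + rho2 (m x) * v2 (m x) * (e2 * c2\<^sup>2)) x"
    by (intro has_two_derivatives_add[where f = "\<lambda>y. A y + B y" for A B]
        has_two_derivatives_cubic_combination m F
        has_two_derivatives_double_zero[OF w1 u1] has_two_derivatives_double_zero[OF w2 u2] T)
  \<comment> \<open>The extra factor \<open>v\<close> raises each order by one; the resulting moment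
    of order four is the last component of the flux by definition.\<close>
  moreover have "\<forall>\<^sub>F y in nhds x. entropy_flux S (m y)
      = h0 * m y $ 2 + h1 * m y $ 3 + h2 * m y $ 4 + h3 * flux (m y) $ 4
        + rho1 (m y) * v1 (m y) * T (v1 (m y)) + rho2 (m y) * v2 (m y) * T (v2 (m y))"
    using Q by eventually_elim
      (simp add: entropy_flux_def is_quadrature_def flux_nth T_def H_def algebra_simps
        power2_eq_square power3_eq_cube power4_eq_xxxx)
  ultimately show "\<exists>b. has_two_derivatives (\<lambda>y. entropy_flux S (m y))
      (h0 * m' 2 + h1 * m' 3 + h2 * m' 4 + h3 * F') b x"
    by (intro exI) (rule has_two_derivatives_cong, simp_all)
qed

section \<open>The entropy inequality at a point\<close>

lemma twice_differentiable_flux: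
  fixes m :: "real \<Rightarrow> real ^ 4"
  assumes m: "\<And>k. twice_differentiable (\<lambda>y. m y $ k) x"
    and ev: "\<forall>\<^sub>F y in nhds x. m y \<in> moment_space"
  shows "twice_differentiable (\<lambda>y. flux (m y) $ k) x"
proof -
  have "k = 1 \<or> k = 2 \<or> k = 3 \<or> k = 4" using exhaust_4 by blast
  thus ?thesis
    by (elim disjE) (auto simp: flux_nth
        intro!: m twice_differentiable_add twice_differentiable_mult twice_differentiable_power
          twice_differentiable_quadrature[OF m ev])
qed

text \<open>The four derivatives are given as functions, so that one argument covers iterated
  \<open>deriv\<close> of a smooth function as well as explicit derivatives of a power.\<close>

lemma entropy_inequality_of_fourth_derivative_nonneg:
  fixes S S1 S2 S3 S4 :: "real \<Rightarrow> real"
  assumes "\<epsilon> \<ge> 0" and "open D" and C: "Ck_on 2 D M" and D: "M ` D \<subseteq> moment_space"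
    and sol: "viscous_solution \<epsilon> D M"
    and S: "\<And>v. (S has_real_derivative S1 v) (at v)"
    and S1: "\<And>v. (S1 has_real_derivative S2 v) (at v)"
    and S2: "\<And>v. (S2 has_real_derivative S3 v) (at v)"
    and S3: "\<And>v. (S3 has_real_derivative S4 v) (at v)"
    and S4: "\<And>v. S4 v \<ge> 0"
  shows "entropy_inequality \<epsilon> D M S"
  unfolding entropy_inequality_def
proof
  fix p assume "p \<in> D"
  obtain t x where p: "p = (t, x)" by (cases p)
  have tx: "(t, x) \<in> D" using \<open>p \<in> D\<close> p by simp
  have ct: "((\<lambda>s. (s, x)) has_vector_derivative (1, 0)) (at s)" for s
    by (auto intro!: derivative_eq_intros simp: has_vector_derivative_def)
  have cx: "((\<lambda>y. (t, y)) has_vector_derivative (0, 1)) (at y)" for y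
    by (auto intro!: derivative_eq_intros simp: has_vector_derivative_def)
  have tdt: "twice_differentiable (\<lambda>s. M (s, x) $ k) t" for k
    by (rule twice_differentiable_along_line[OF C \<open>open D\<close> ct tx])
  then obtain A A2 where A: "\<And>k. has_two_derivatives (\<lambda>s. M (s, x) $ k) (A k) (A2 k) t"
    unfolding twice_differentiable_def by metis
  have tdx: "twice_differentiable (\<lambda>y. M (t, y) $ k) x" for k
    by (rule twice_differentiable_along_line[OF C \<open>open D\<close> cx tx])
  then obtain B B2 where B: "\<And>k. has_two_derivatives (\<lambda>y. M (t, y) $ k) (B k) (B2 k) x"
    unfolding twice_differentiable_def by metis
  have nhd: "\<forall>\<^sub>F q in nhds (t, x). q \<in> D"
    using \<open>open D\<close> tx by (rule eventually_nhds_in_open)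
  have "\<forall>\<^sub>F s in nhds t. (s, x) \<in> D"
    by (rule eventually_compose_filterlim[OF nhd]) (intro tendsto_intros filterlim_ident)
  hence evt: "\<forall>\<^sub>F s in nhds t. M (s, x) \<in> moment_space"
    by eventually_elim (use D in blast)
  have "\<forall>\<^sub>F y in nhds x. (t, y) \<in> D"
    by (rule eventually_compose_filterlim[OF nhd]) (intro tendsto_intros filterlim_ident)
  hence evx: "\<forall>\<^sub>F y in nhds x. M (t, y) \<in> moment_space"
    by eventually_elim (use D in blast)
  obtain E E2 where E: "\<And>k. has_two_derivatives (\<lambda>s. flux (M (s, x)) $ k) (E k) (E2 k) t"
    using twice_differentiable_flux[OF tdt evt] unfolding twice_differentiable_def by metis
  obtain F F2 where F: "\<And>k. has_two_derivatives (\<lambda>y. flux (M (t, y)) $ k) (F k) (F2 k) x"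
    using twice_differentiable_flux[OF tdx evx] unfolding twice_differentiable_def by metis
  have "partial_t M p + partial_x (flux \<circ> M) p = \<epsilon> *\<^sub>R partial_x (partial_x M) p"
    using sol \<open>p \<in> D\<close> unfolding viscous_solution_def by blast
  hence "(partial_t M p + partial_x (flux \<circ> M) p) $ k = (\<epsilon> *\<^sub>R partial_x (partial_x M) p) $ k" for k
    by simp
  hence eqn: "A k + F k = \<epsilon> * B2 k" for k
    by (simp add: p partial_t_def partial_x_def vector_derivative_nth[OF A]
        vector_derivative_nth[OF F] vector_derivative2_nth[OF B])
  \<comment> \<open>The first three flux components are the moments shifted by one place, and
    derivatives are unique.\<close>
  have "F 1 = B 2" "F 2 = B 3" "F 3 = B 4"
    using has_two_derivatives_imp_DERIV[OF F[of 1]] has_two_derivatives_imp_DERIV[OF F[of 2]]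
      has_two_derivatives_imp_DERIV[OF F[of 3]] has_two_derivatives_imp_DERIV[OF B[of 2]]
      has_two_derivatives_imp_DERIV[OF B[of 3]] has_two_derivatives_imp_DERIV[OF B[of 4]]
    by (auto simp: flux_nth intro: DERIV_unique)
  with eqn[of 1] eqn[of 2] eqn[of 3] eqn[of 4]
  have eqns: "A 1 + B 2 = \<epsilon> * B2 1" "A 2 + B 3 = \<epsilon> * B2 2" "A 3 + B 4 = \<epsilon> * B2 3"
    "A 4 + F 4 = \<epsilon> * B2 4" by simp_all
  define a where "a = v1 (M (t, x))"
  define b where "b = v2 (M (t, x))"
  have "is_quadrature (M (t, x)) (rho1 (M (t, x)), rho2 (M (t, x)), a, b)"
    unfolding a_def b_def using D tx by (intro is_quadrature_quadrature) blast
  hence pos: "rho1 (M (t, x)) > 0" "rho2 (M (t, x)) > 0" "b < a"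
    by (auto simp: is_quadrature_def)
  obtain h0 h1 h2 h3 where
    h: "h0 + h1 * a + h2 * a\<^sup>2 + h3 * a ^ 3 = S a" "h1 + 2 * h2 * a + 3 * h3 * a\<^sup>2 = S1 a"
    "h0 + h1 * b + h2 * b\<^sup>2 + h3 * b ^ 3 = S b" "h1 + 2 * h2 * b + 3 * h3 * b\<^sup>2 = S1 b"
    using hermite_interpolation[of a b "S a" "S1 a" "S b" "S1 b"] pos by blast
  define T where "T v = S v - (h0 + h1 * v + h2 * v\<^sup>2 + h3 * v ^ 3)" for v
  define T1 where "T1 v = S1 v - (h1 + 2 * h2 * v + 3 * h3 * v\<^sup>2)" for v
  define T2 where "T2 v = S2 v - (2 * h2 + 6 * h3 * v)" for v
  define T3 where "T3 v = S3 v - 6 * h3" for v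
  have dT: "(T has_real_derivative T1 v) (at v)" for v
    unfolding T_def T1_def by (auto intro!: derivative_eq_intros S simp: power2_eq_square)
  have dT1: "(T1 has_real_derivative T2 v) (at v)" for v
    unfolding T1_def T2_def by (auto intro!: derivative_eq_intros S1)
  have dT2: "(T2 has_real_derivative T3 v) (at v)" for v
    unfolding T2_def T3_def by (auto intro!: derivative_eq_intros S2)
  \<comment> \<open>Subtracting a cubic leaves the fourth derivative unchanged, so the sign
    condition on \<open>S4\<close> passes to the remainder.\<close>
  have dT3: "(T3 has_real_derivative S4 v) (at v)" for v
    unfolding T3_def by (auto intro!: derivative_eq_intros S3)
  have zero: "T a = 0" "T b = 0" "T1 a = 0" "T1 b = 0"
    using h by (simp_all add: T_def T1_def)
  have T2: "T2 a \<ge> 0" "T2 b \<ge> 0"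
    using second_derivative_nonneg_at_double_zeros[OF dT dT1 dT2 dT3 S4 zero \<open>b < a\<close>] by auto
  have Ta: "has_two_derivatives (\<lambda>v. S v - (h0 + h1 * v + h2 * v\<^sup>2 + h3 * v ^ 3)) 0 (T2 a) a"
    and Tb: "has_two_derivatives (\<lambda>v. S v - (h0 + h1 * v + h2 * v\<^sup>2 + h3 * v ^ 3)) 0 (T2 b) b"
    using has_two_derivatives_of_DERIV[OF dT dT1, of a] has_two_derivatives_of_DERIV[OF dT dT1, of b]
      zero by (simp_all add: T_def[abs_def])
  \<comment> \<open>The lines in \<open>t\<close> and in \<open>x\<close> meet at
    \<open>(t, x)\<close>, so a single interpolant serves both directions.\<close>
  note interp = Ta[unfolded a_def] h(1)[symmetric, unfolded a_def]
    Tb[unfolded b_def] h(3)[symmetric, unfolded b_def]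
  obtain et where et: "has_two_derivatives (\<lambda>s. entropy S (M (s, x)))
      (h0 * A 1 + h1 * A 2 + h2 * A 3 + h3 * A 4) et t"
    using entropy_pair_along_curve(1)[OF A evt E interp] by blast
  obtain c1 c2 where ex: "has_two_derivatives (\<lambda>y. entropy S (M (t, y)))
      (h0 * B 1 + h1 * B 2 + h2 * B 3 + h3 * B 4)
      (h0 * B2 1 + h1 * B2 2 + h2 * B2 3 + h3 * B2 4
        + rho1 (M (t, x)) * (T2 a * c1\<^sup>2) + rho2 (M (t, x)) * (T2 b * c2\<^sup>2)) x"
    using entropy_pair_along_curve(1)[OF B evx F interp] unfolding a_def b_def by blast
  obtain qx where qx: "has_two_derivatives (\<lambda>y. entropy_flux S (M (t, y)))
      (h0 * B 2 + h1 * B 3 + h2 * B 4 + h3 * F 4) qx x"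
    using entropy_pair_along_curve(2)[OF B evx F interp] by blast
  \<comment> \<open>Only the interpolant is left in the first derivatives; grouping by its
    coefficients produces the left sides of the four scalar equations.\<close>
  have "partial_t (entropy S \<circ> M) p + partial_x (entropy_flux S \<circ> M) p
      = h0 * (A 1 + B 2) + h1 * (A 2 + B 3) + h2 * (A 3 + B 4) + h3 * (A 4 + F 4)"
    by (simp add: p partial_t_def partial_x_def has_two_derivatives_imp_vector_derivative[OF et]
        has_two_derivatives_imp_vector_derivative[OF qx] algebra_simps)
  also have "\<dots> = \<epsilon> * (h0 * B2 1 + h1 * B2 2 + h2 * B2 3 + h3 * B2 4)"
    unfolding eqns by (simp add: algebra_simps)
  \<comment> \<open>The added terms are products of positive weights, nonnegative values of
    \<open>T2\<close> and squares.\<close>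
  also have "\<dots> \<le> \<epsilon> * (h0 * B2 1 + h1 * B2 2 + h2 * B2 3 + h3 * B2 4
        + rho1 (M (t, x)) * (T2 a * c1\<^sup>2) + rho2 (M (t, x)) * (T2 b * c2\<^sup>2))"
    using pos T2 \<open>\<epsilon> \<ge> 0\<close> by (intro mult_left_mono) auto
  also have "\<dots> = \<epsilon> * partial_x (partial_x (entropy S \<circ> M)) p"
    by (simp add: p partial_x_def has_two_derivatives_imp_vector_derivative2[OF ex])
  finally show "partial_t (entropy S \<circ> M) p + partial_x (entropy_flux S \<circ> M) p
      \<le> \<epsilon> * partial_x (partial_x (entropy S \<circ> M)) p" .
qed

section \<open>Smooth entropies and even powers\<close>

theorem proposition3p3:
  fixes \<epsilon> :: real
    and D :: "(real \<times> real) set"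
    and M :: "real \<times> real \<Rightarrow> real ^ 4"
  assumes "\<epsilon> > 0"
    and "open D"
    and "smooth_on D M"
    and "M ` D \<subseteq> moment_space"
    and "viscous_solution \<epsilon> D M"
  shows "(\<forall>S. smooth_on UNIV S \<and> (\<forall>v. (deriv ^^ 4) S v \<ge> 0) \<longrightarrow> entropy_inequality \<epsilon> D M S)
    \<and> (\<forall>\<alpha>::nat. \<alpha> \<ge> 2 \<longrightarrow> entropy_inequality \<epsilon> D M (\<lambda>v. v ^ (2 * \<alpha>)))"
proof (intro conjI allI impI)
  have C: "Ck_on 2 D M" using assms(3) by (simp add: smooth_on_def)
  note main = entropy_inequality_of_fourth_derivative_nonneg
    [OF less_imp_le[OF assms(1)] assms(2) C assms(4,5)]
  show "entropy_inequality \<epsilon> D M S" if "smooth_on UNIV S \<and> (\<forall>v. (deriv ^^ 4) S v \<ge> 0)" for S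
  proof -
    have "Ck_on 4 UNIV S" using that by (simp add: smooth_on_def)
    note d = Ck_on_imp_DERIV[OF this]
    show ?thesis
      by (rule main[of S "(deriv ^^ 1) S" "(deriv ^^ 2) S" "(deriv ^^ 3) S" "(deriv ^^ 4) S"])
        (use that d[of 0] d[of 1] d[of 2] d[of 3] in \<open>simp_all add: eval_nat_numeral\<close>)
  qed
  show "entropy_inequality \<epsilon> D M (\<lambda>v. v ^ (2 * \<alpha>))" if "\<alpha> \<ge> 2" for \<alpha> :: nat
  proof -
    \<comment> \<open>Writing the exponent as \<open>2 * n + 4\<close> lets four differentiations
      proceed without truncated subtraction and end at the even power \<open>v ^ (2 * n)\<close>,
      which is nonnegative; so are the factors \<open>c + 1\<close> to \<open>c + 4\<close>.\<close>
    obtain n where n: "2 * \<alpha> = 2 * n + 4" using \<open>\<alpha> \<ge> 2\<close> by (auto simp: le_iff_add)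
    define c where "c = real (2 * n)"
    have power: "((\<lambda>v. k * v ^ Suc i) has_real_derivative k * (real i + 1) * v ^ i) (at v)"
      for k v :: real and i
      using DERIV_cmult[OF DERIV_pow[of "Suc i" v], of k] by (simp add: algebra_simps)
    show ?thesis unfolding n
    proof (rule main)
      show "((\<lambda>v. v ^ (2 * n + 4)) has_real_derivative (c + 4) * v ^ (2 * n + 3)) (at v)"
        and "((\<lambda>v. (c + 4) * v ^ (2 * n + 3)) has_real_derivative
          (c + 4) * (c + 3) * v ^ (2 * n + 2)) (at v)"
        and "((\<lambda>v. (c + 4) * (c + 3) * v ^ (2 * n + 2)) has_real_derivative
          (c + 4) * (c + 3) * (c + 2) * v ^ (2 * n + 1)) (at v)"
        and "((\<lambda>v. (c + 4) * (c + 3) * (c + 2) * v ^ (2 * n + 1)) has_real_derivative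
          (c + 4) * (c + 3) * (c + 2) * (c + 1) * v ^ (2 * n)) (at v)" for v
        using power[of 1 "2 * n + 3" v] power[of "c + 4" "2 * n + 2" v]
          power[of "(c + 4) * (c + 3)" "2 * n + 1" v]
          power[of "(c + 4) * (c + 3) * (c + 2)" "2 * n" v]
        by (simp_all add: c_def eval_nat_numeral algebra_simps)
      show "(c + 4) * (c + 3) * (c + 2) * (c + 1) * v ^ (2 * n) \<ge> 0" for v
        by (simp add: c_def)
    qed
  qed
qed

end
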